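(* For every integer $n>1$, $$\sum_{p\in T_{n,n-1}}q^{\operatorname{minimal}(p)}=q^{\binom n2}\,C_{n-1}(q^{-1}),$$ where $C_m(q)$ is the Carlitz–Riordan $q$-Catalan number.
   Context: $\overrightarrow{K}_n$ is the transitive tournament with vertices $v_1,\dots,v_n$ and directed edges $(v_i,v_j)$, $i<j$. $T_{n,n-1}$ is the set of maximal transitive partitions of $\overrightarrow{K}_n$: unordered partitions of the edge set into $n-1$ nonempty blocks such that every cycle of the underlying undirected graph contains two edges in the same block with opposite orientations with respect to a traversal of the cycle. An edge $(v_i,v_j)$, $i<j$, is minimal in $p$ if every edge $(v_a,v_b)$, $a<b$, in the block of $p$ containing $(v_i,v_j)$ satisfies $i\le a$. $\operatorname{minimal}(p)$ is the number of minimal edges in $p$. The $q$-Catalan numbers are defined by $C_0(q):=1$ and $C_{m+1}(q):=\sum_{k=0}^{m}q^{(k+1)(m-k)}C_k(q)C_{m-k}(q)$ for $m\ge 0$. *)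

theory Defs
  imports Main "HOL-Library.Disjoint_Sets"
begin

definition tournament_edges :: "nat \<Rightarrow> (nat \<times> nat) set" where
  "tournament_edges n = {(i, j). 1 \<le> i \<and> i < j \<and> j \<le> n}"

text \<open>The cyclically consecutive pairs of a vertex sequence, each pointing in the
  direction of traversal.\<close>

definition cycle_steps :: "'v list \<Rightarrow> ('v \<times> 'v) set" where
  "cycle_steps vs = set (zip vs (rotate1 vs))"

definition undirected_cycle :: "('v \<times> 'v) set \<Rightarrow> 'v list \<Rightarrow> bool" where
  "undirected_cycle E vs \<longleftrightarrow>
     3 \<le> length vs \<and> distinct vs \<and> cycle_steps vs \<subseteq> E \<union> E\<inverse>"

text \<open>A directed edge is traversed forwards if it lies in \<open>cycle_steps vs\<close>, and backwards
  if it lies in the converse relation.\<close>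

definition transitive_partition :: "('v \<times> 'v) set \<Rightarrow> ('v \<times> 'v) set set \<Rightarrow> bool" where
  "transitive_partition E p \<longleftrightarrow> partition_on E p \<and>
     (\<forall>vs. undirected_cycle E vs \<longrightarrow>
        (\<exists>B\<in>p. \<exists>e\<in>B. \<exists>f\<in>B. e \<in> cycle_steps vs \<and> f \<in> (cycle_steps vs)\<inverse>))"

definition max_transitive_partitions :: "nat \<Rightarrow> (nat \<times> nat) set set set" where
  "max_transitive_partitions n =
     {p. transitive_partition (tournament_edges n) p \<and> card p = n - 1}"

definition minimal_edges :: "(nat \<times> nat) set set \<Rightarrow> (nat \<times> nat) set" where
  "minimal_edges p = {(i, j). \<exists>B\<in>p. (i, j) \<in> B \<and> (\<forall>(a, b)\<in>B. i \<le> a)}"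

definition minimal :: "(nat \<times> nat) set set \<Rightarrow> nat" where
  "minimal p = card (minimal_edges p)"

fun q_catalan :: "nat \<Rightarrow> 'a::comm_semiring_1 \<Rightarrow> 'a" where
  "q_catalan 0 q = 1"
| "q_catalan (Suc m) q =
     (\<Sum>k\<le>m. q ^ ((k + 1) * (m - k)) * q_catalan k q * q_catalan (m - k) q)"

end

theory Submission
  imports Defs
begin

text \<open>A partition of the edges is transitive iff it satisfies the cycle condition on triangles,
  i.e. for \<open>i < j < k\<close> the edge \<open>(i, k)\<close> shares its block with \<open>(i, j)\<close> or \<open>(j, k)\<close>: a longer cycle
  can be shortened by replacing two consecutive steps by a chord. Then every block contains an edge
  \<open>(m, m + 1)\<close>, and for \<open>n - 1\<close> blocks it contains exactly one. If \<open>(r, r + 1)\<close> lies in the block of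
  \<open>(1, n)\<close>, that block is \<open>{1..r} \<times> {r+1..n}\<close> and the other blocks form maximal transitive partitions of
  the tournaments on \<open>{1..r}\<close> and \<open>{r+1..n}\<close>. The minimal edges of the block of \<open>(1, n)\<close> are the \<open>n - r\<close>
  edges \<open>(1, k)\<close> with \<open>k > r\<close>, so the generating function satisfies the recursion
  \<open>M\<^sub>n = (\<Sum>r. q ^ (n - r) * M\<^sub>r * M\<^sub>n\<^sub>-\<^sub>r)\<close> that characterises the right-hand side.\<close>

section \<open>Tournaments on an interval of vertices and the triangle condition\<close>

text \<open>Arbitrary endpoints are allowed because the right-hand part of a decomposition starts at
  \<open>r + 1\<close> rather than at 1.\<close>

definition interval_edges :: "nat \<Rightarrow> nat \<Rightarrow> (nat \<times> nat) set" where
  "interval_edges a b = {(i, j). a \<le> i \<and> i < j \<and> j \<le> b}"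

text \<open>This is the cycle condition on a triangle: traversing \<open>i, j, k\<close> runs along
  \<open>(i, j)\<close> and \<open>(j, k)\<close> but against \<open>(i, k)\<close>, so
  \<open>(i, k)\<close> has to share its block with one of the other two.\<close>

definition triangle_condition :: "(nat \<times> nat) set set \<Rightarrow> bool" where
  "triangle_condition p \<longleftrightarrow>
     (\<forall>B\<in>p. \<forall>i j k. i < j \<longrightarrow> j < k \<longrightarrow> (i, k) \<in> B \<longrightarrow> (i, j) \<in> B \<or> (j, k) \<in> B)"

definition interval_partitions :: "nat \<Rightarrow> nat \<Rightarrow> (nat \<times> nat) set set set" where
  "interval_partitions a b =
     {p. partition_on (interval_edges a b) p \<and> triangle_condition p \<and> card p = b - a}"

lemma triangle_conditionD:
  assumes "triangle_condition p" "B \<in> p" "i < j" "j < k" "(i, k) \<in> B"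
  shows "(i, j) \<in> B \<or> (j, k) \<in> B"
  using assms unfolding triangle_condition_def by blast

lemma finite_interval_edges: "finite (interval_edges a b)"
  by (rule finite_subset[of _ "{a..b} \<times> {a..b}"]) (auto simp: interval_edges_def)

lemma partition_on_Un:
  assumes "partition_on A P" "partition_on B Q" "A \<inter> B = {}"
  shows "partition_on (A \<union> B) (P \<union> Q)"
proof -
  have "(\<Union>P) \<inter> (\<Union>Q) = {}"
    using assms by (simp add: partition_on_def)
  then have "disjoint (P \<union> Q)"
    by (intro disjoint_union partition_onD2[OF assms(1)] partition_onD2[OF assms(2)])
  then show ?thesis using assms(1,2) by (simp add: partition_on_def)
qed

lemma partition_on_unique_block:
  assumes "partition_on A p" "x \<in> B" "x \<in> C" "B \<in> p" "C \<in> p"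
  shows "B = C"
  using partition_onD2[OF assms(1)] assms unfolding disjoint_def by blast

lemma interval_partition_edge_bounds:
  assumes "partition_on (interval_edges a b) p" "B \<in> p" "(i, k) \<in> B"
  shows "a \<le> i" "i < k" "k \<le> b"
  using partition_onD1[OF assms(1)] assms(2,3) by (auto simp: interval_edges_def)

section \<open>Reduction to triangles\<close>

lemma cycle_steps_Cons_Cons:
  "cycle_steps (x # z # ws) = insert (x, z) (set (zip (z # ws) (ws @ [x])))"
  by (simp add: cycle_steps_def)

text \<open>Induction on the length, deleting the second vertex. Starting at length 2 makes the base
  case trivial: the closed walk \<open>x, y, x\<close> uses its only edge in both
  directions.\<close>

lemma triangle_condition_cycle:
  assumes part: "partition_on (interval_edges a b) p" and tri: "triangle_condition p"
    and "2 \<le> length vs" "distinct vs" "set vs \<subseteq> {a..b}"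
  shows "\<exists>B\<in>p. \<exists>e\<in>B. \<exists>f\<in>B. e \<in> cycle_steps vs \<and> f \<in> (cycle_steps vs)\<inverse>"
  using assms(3-)
proof (induction "length vs" arbitrary: vs rule: less_induct)
  case less
  have block: "\<exists>B\<in>p. (i, j) \<in> B" if "i \<in> {a..b}" "j \<in> {a..b}" "i < j" for i j
    using partition_onD1[OF part] that by (auto simp: interval_edges_def)
  have tri': "\<And>B i j k. B \<in> p \<Longrightarrow> i < j \<Longrightarrow> j < k \<Longrightarrow> (i, k) \<in> B \<Longrightarrow> (i, j) \<in> B \<or> (j, k) \<in> B"
    using triangle_conditionD[OF tri] by blast
  from less.prems obtain x y us where vs: "vs = x # y # us"
    by (metis Suc_le_length_iff numeral_2_eq_2)
  show ?case
  proof (cases us)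
    case Nil
    have "x < y \<or> y < x" using less.prems vs by auto
    then show ?thesis
    proof
      assume "x < y"
      with block[of x y] less.prems vs obtain B where "B \<in> p" "(x, y) \<in> B" by auto
      then show ?thesis
        by (intro bexI[of _ B] bexI[of _ "(x, y)"]) (simp_all add: vs Nil cycle_steps_def)
    next
      assume "y < x"
      with block[of y x] less.prems vs obtain B where "B \<in> p" "(y, x) \<in> B" by auto
      then show ?thesis
        by (intro bexI[of _ B] bexI[of _ "(y, x)"]) (simp_all add: vs Nil cycle_steps_def)
    qed
  next
    case (Cons z ws)
    define S where "S = set (zip (z # ws) (ws @ [x]))"
    have short: "cycle_steps (x # z # ws) = insert (x, z) S"
      unfolding S_def by (rule cycle_steps_Cons_Cons)
    have long: "cycle_steps vs = insert (x, y) (insert (y, z) S)"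
      unfolding S_def vs Cons by (simp add: cycle_steps_def)
    have "\<exists>B\<in>p. \<exists>e\<in>B. \<exists>f\<in>B. e \<in> cycle_steps (x # z # ws) \<and> f \<in> (cycle_steps (x # z # ws))\<inverse>"
      using less.hyps[of "x # z # ws"] less.prems vs Cons by simp
    then obtain B e f where B: "B \<in> p" "e \<in> B" "f \<in> B" "e \<in> insert (x, z) S" "f \<in> (insert (x, z) S)\<inverse>"
      unfolding short by blast
    have ranges: "x \<in> {a..b}" "y \<in> {a..b}" "z \<in> {a..b}" and ne: "x \<noteq> y" "y \<noteq> z" "x \<noteq> z"
      using less.prems vs Cons by auto
    \<comment> \<open>Either the two steps at \<open>y\<close> already form an opposite pair in one
      block, or every block containing the chord between \<open>x\<close> and \<open>z\<close> also
      contains one of these two steps, traversed in the same direction as the chord.\<close>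
    have chord: "?thesis \<or> (\<forall>B\<in>p. ((x, z) \<in> B \<longrightarrow> (x, y) \<in> B \<or> (y, z) \<in> B) \<and>
        ((z, x) \<in> B \<longrightarrow> (y, x) \<in> B \<or> (z, y) \<in> B))"
    proof (cases "\<exists>B\<in>p. ((x, y) \<in> B \<and> (z, y) \<in> B) \<or> ((y, x) \<in> B \<and> (y, z) \<in> B)")
      case True
      then show ?thesis unfolding long by blast
    next
      case False
      have edge: "B \<in> p \<Longrightarrow> (i, j) \<in> B \<Longrightarrow> i < j" for B i j
        using interval_partition_edge_bounds[OF part] by blast
      have uniq: "B \<in> p \<Longrightarrow> C \<in> p \<Longrightarrow> e \<in> B \<Longrightarrow> e \<in> C \<Longrightarrow> B = C" for B C e
        using partition_on_unique_block[OF part] by blast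
      have "(x, y) \<in> B \<or> (y, z) \<in> B" if "B \<in> p" "(x, z) \<in> B" for B
      proof -
        have "x < z" using edge that by blast
        consider "y < x" | "x < y" "y < z" | "z < y" using ne by linarith
        then show ?thesis
        proof cases
          \<comment> \<open>Now \<open>(y, z)\<close> is the long side of the triangle. Its block
            cannot contain \<open>(y, x)\<close>, which is traversed oppositely, so it contains
            \<open>(x, z)\<close> and is \<open>B\<close>. The other outer cases are alike.\<close>
          case 1
          obtain C where C: "C \<in> p" "(y, z) \<in> C"
            using block[of y z] ranges 1 \<open>x < z\<close> by auto
          then have "(y, x) \<in> C \<or> (x, z) \<in> C"
            using tri'[of C y x z] 1 \<open>x < z\<close> by blast
          then show ?thesis using False C that uniq[of B C "(x, z)"] by blast
        next
          case 2
          then show ?thesis using tri' that by blast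
        next
          case 3
          obtain C where C: "C \<in> p" "(x, y) \<in> C"
            using block[of x y] ranges 3 \<open>x < z\<close> by auto
          then have "(x, z) \<in> C \<or> (z, y) \<in> C"
            using tri'[of C x z y] 3 \<open>x < z\<close> by blast
          then show ?thesis using False C that uniq[of B C "(x, z)"] by blast
        qed
      qed
      moreover have "(y, x) \<in> B \<or> (z, y) \<in> B" if "B \<in> p" "(z, x) \<in> B" for B
      proof -
        have "z < x" using edge that by blast
        consider "y < z" | "z < y" "y < x" | "x < y" using ne by linarith
        then show ?thesis
        proof cases
          case 1
          obtain C where C: "C \<in> p" "(y, x) \<in> C"
            using block[of y x] ranges 1 \<open>z < x\<close> by auto
          then have "(y, z) \<in> C \<or> (z, x) \<in> C"
            using tri'[of C y z x] 1 \<open>z < x\<close> by blast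
          then show ?thesis using False C that uniq[of B C "(z, x)"] by blast
        next
          case 2
          then show ?thesis using tri' that by blast
        next
          case 3
          obtain C where C: "C \<in> p" "(z, y) \<in> C"
            using block[of z y] ranges 3 \<open>z < x\<close> by auto
          then have "(z, x) \<in> C \<or> (x, y) \<in> C"
            using tri'[of C z x y] 3 \<open>z < x\<close> by blast
          then show ?thesis using False C that uniq[of B C "(z, x)"] by blast
        qed
      qed
      ultimately show ?thesis by blast
    qed
    show ?thesis
    proof (rule ccontr)
      assume contra: "\<not> ?thesis"
      \<comment> \<open>If \<open>e\<close> or \<open>f\<close> is the chord of the shortened cycle,
        \<open>chord\<close> replaces it by a step of \<open>vs\<close> with the same direction in
        the same block.\<close>
      have "\<exists>e\<in>B. e \<in> cycle_steps vs" "\<exists>f\<in>B. f \<in> (cycle_steps vs)\<inverse>"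
        using chord contra B unfolding long by blast+
      with contra B(1) show False by blast
    qed
  qed
qed

text \<open>One direction instantiates the cycle condition at triangles; the other is
  \<open>triangle_condition_cycle\<close>.\<close>

lemma transitive_partition_interval_iff:
  "transitive_partition (interval_edges a b) p \<longleftrightarrow>
     partition_on (interval_edges a b) p \<and> triangle_condition p"
proof (intro iffI conjI)
  assume trans: "transitive_partition (interval_edges a b) p"
  then show part: "partition_on (interval_edges a b) p"
    by (simp add: transitive_partition_def)
  have edge: "B \<in> p \<Longrightarrow> e \<in> B \<Longrightarrow> e \<in> interval_edges a b" for B e
    using partition_onD1[OF part] by blast
  show "triangle_condition p"
    unfolding triangle_condition_def
  proof (intro ballI allI impI)
    fix B i j k
    assume B: "B \<in> p" and ij: "i < j" and jk: "j < k" and ik: "(i, k) \<in> B"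
    have bounds: "a \<le> i" "k \<le> b" using edge[OF B ik] by (auto simp: interval_edges_def)
    have steps: "cycle_steps [i, j, k] = {(i, j), (j, k), (k, i)}"
      by (simp add: cycle_steps_def)
    have "undirected_cycle (interval_edges a b) [i, j, k]"
      using bounds ij jk by (auto simp: undirected_cycle_def steps interval_edges_def)
    then obtain C e f where C: "C \<in> p" "e \<in> C" "f \<in> C"
        "e \<in> {(i, j), (j, k), (k, i)}" "f \<in> {(i, j), (j, k), (k, i)}\<inverse>"
      using trans unfolding transitive_partition_def steps[symmetric] by blast
    \<comment> \<open>Edges point upwards, so the step \<open>(k, i)\<close> is not an edge, and
      \<open>(i, k)\<close> is the only edge traversed backwards.\<close>
    have "e = (i, j) \<or> e = (j, k)"
      using C edge[OF C(1,2)] ij jk by (auto simp: interval_edges_def)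
    moreover have "f = (i, k)"
      using C edge[OF C(1,3)] ij jk by (auto simp: interval_edges_def)
    ultimately show "(i, j) \<in> B \<or> (j, k) \<in> B"
      using partition_on_unique_block[OF part ik _ B C(1)] C by blast
  qed
next
  assume *: "partition_on (interval_edges a b) p \<and> triangle_condition p"
  show "transitive_partition (interval_edges a b) p"
    unfolding transitive_partition_def
  proof (intro conjI allI impI)
    fix vs
    assume cyc: "undirected_cycle (interval_edges a b) vs"
    have "set vs \<subseteq> {a..b}"
    proof
      fix v assume "v \<in> set vs"
      then obtain i where i: "i < length vs" "vs ! i = v" by (auto simp: in_set_conv_nth)
      then have "(v, rotate1 vs ! i) \<in> cycle_steps vs"
        by (force simp: cycle_steps_def in_set_zip)
      then have "(v, rotate1 vs ! i) \<in> interval_edges a b \<union> (interval_edges a b)\<inverse>"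
        using cyc by (auto simp: undirected_cycle_def)
      then show "v \<in> {a..b}" by (auto simp: interval_edges_def)
    qed
    then show "\<exists>B\<in>p. \<exists>e\<in>B. \<exists>f\<in>B. e \<in> cycle_steps vs \<and> f \<in> (cycle_steps vs)\<inverse>"
      using triangle_condition_cycle[of a b p vs] * cyc by (auto simp: undirected_cycle_def)
  qed (use * in blast)
qed

lemma max_transitive_partitions_eq: "max_transitive_partitions n = interval_partitions 1 n"
proof -
  have "tournament_edges n = interval_edges 1 n"
    by (simp add: tournament_edges_def interval_edges_def)
  then show ?thesis
    by (simp add: max_transitive_partitions_def interval_partitions_def
        transitive_partition_interval_iff)
qed

section \<open>Decomposition at the block of the longest edge\<close>

text \<open>The triangle \<open>i, i + 1, k\<close> puts \<open>(i, i + 1)\<close> or the shorter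
  edge \<open>(i + 1, k)\<close> into the block; repeat with the latter.\<close>

lemma triangle_condition_consecutive_edge:
  assumes tri: "triangle_condition p" and "B \<in> p" "(i, k) \<in> B" "i < k"
  shows "\<exists>m. i \<le> m \<and> m < k \<and> (m, Suc m) \<in> B"
  using assms(3,4)
proof (induction "k - i" arbitrary: i rule: less_induct)
  case less
  show ?case
  proof (cases "k = Suc i")
    case True
    then show ?thesis using less.prems by auto
  next
    case False
    then have "(i, Suc i) \<in> B \<or> (Suc i, k) \<in> B"
      using triangle_conditionD[OF tri \<open>B \<in> p\<close>, of i "Suc i" k] less.prems by auto
    then show ?thesis
    proof
      assume "(Suc i, k) \<in> B"
      then show ?thesis
        using less.hyps[of "Suc i"] less.prems False
        by (metis Suc_leD Suc_lessI diff_less_mono2 lessI)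
    qed (use less.prems in auto)
  qed
qed

text \<open>Meaningful only when \<open>(m, Suc m)\<close> is an edge of the partitioned set;
  disjointness of the blocks then makes the choice unique.\<close>

definition consecutive_block :: "(nat \<times> nat) set set \<Rightarrow> nat \<Rightarrow> (nat \<times> nat) set" where
  "consecutive_block p m = (THE B. B \<in> p \<and> (m, Suc m) \<in> B)"

lemma consecutive_block_eq:
  assumes "partition_on A p" "B \<in> p" "(m, Suc m) \<in> B"
  shows "consecutive_block p m = B"
  unfolding consecutive_block_def
  using assms partition_on_unique_block[OF assms(1)] by (intro the_equality) blast+

lemma consecutive_block_image:
  assumes part: "partition_on (interval_edges a b) p" and tri: "triangle_condition p"
  shows "consecutive_block p ` {a..<b} = p"
proof
  show "consecutive_block p ` {a..<b} \<subseteq> p"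
  proof
    fix C assume "C \<in> consecutive_block p ` {a..<b}"
    then obtain m where m: "m \<in> {a..<b}" "C = consecutive_block p m" by blast
    then have "(m, Suc m) \<in> \<Union>p"
      using partition_onD1[OF part] by (auto simp: interval_edges_def)
    then show "C \<in> p" using m consecutive_block_eq[OF part] by auto
  qed
  show "p \<subseteq> consecutive_block p ` {a..<b}"
  proof
    fix B assume B: "B \<in> p"
    then have "B \<noteq> {}" using partition_onD3[OF part] by blast
    then obtain i k where ik: "(i, k) \<in> B" by fast
    then have "a \<le> i" "i < k" "k \<le> b"
      using interval_partition_edge_bounds[OF part B] by blast+
    moreover obtain m where "i \<le> m" "m < k" "(m, Suc m) \<in> B"
      using triangle_condition_consecutive_edge[OF tri B ik \<open>i < k\<close>] by blast
    ultimately show "B \<in> consecutive_block p ` {a..<b}"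
      using consecutive_block_eq[OF part B] by (intro image_eqI[of _ _ m]) auto
  qed
qed

text \<open>The consecutive edges reach all blocks and there are only \<open>b - a\<close> of them.
  This explains why \<open>n - 1\<close> blocks are called maximal.\<close>

lemma card_interval_partition_le:
  assumes "partition_on (interval_edges a b) p" "triangle_condition p"
  shows "card p \<le> b - a"
  using card_image_le[of "{a..<b}" "consecutive_block p"] consecutive_block_image[OF assms] by simp

text \<open>A surjection between finite sets of equal size is injective, here applied to
  \<open>consecutive_block p\<close>.\<close>

lemma consecutive_edge_unique:
  assumes p: "p \<in> interval_partitions a b" and B: "B \<in> p" "(m, Suc m) \<in> B" "(m', Suc m') \<in> B"
  shows "m = m'"
proof -
  have part: "partition_on (interval_edges a b) p" and tri: "triangle_condition p"
    and card: "card p = b - a"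
    using p by (auto simp: interval_partitions_def)
  have "inj_on (consecutive_block p) {a..<b}"
    using consecutive_block_image[OF part tri] card by (intro eq_card_imp_inj_on) auto
  moreover have "m \<in> {a..<b}" "m' \<in> {a..<b}"
    using interval_partition_edge_bounds[OF part B(1,2)] interval_partition_edge_bounds[OF part B(1,3)]
    by auto
  moreover have "consecutive_block p m = consecutive_block p m'"
    using B consecutive_block_eq[OF part] by metis
  ultimately show ?thesis by (auto dest: inj_onD)
qed

section \<open>Cutting an interval in two and joining the parts\<close>

text \<open>For \<open>a \<le> r\<close> and \<open>r < b\<close> these are the edges crossing the
  cut between \<open>r\<close> and \<open>r + 1\<close>.\<close>

definition split_block :: "nat \<Rightarrow> nat \<Rightarrow> nat \<Rightarrow> (nat \<times> nat) set" where
  "split_block a b r = {a..r} \<times> {Suc r..b}"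

definition join_partitions ::
  "nat \<Rightarrow> nat \<Rightarrow> nat \<Rightarrow> (nat \<times> nat) set set \<Rightarrow> (nat \<times> nat) set set \<Rightarrow> (nat \<times> nat) set set" where
  "join_partitions a b r p1 p2 = insert (split_block a b r) (p1 \<union> p2)"

lemma interval_edges_split:
  assumes "a \<le> r" "r < b"
  shows "interval_edges a b =
    split_block a b r \<union> (interval_edges a r \<union> interval_edges (Suc r) b)"
  using assms by (auto simp: interval_edges_def split_block_def)

lemma interval_edges_split_disjoint:
  "split_block a b r \<inter> interval_edges a r = {}"
  "split_block a b r \<inter> interval_edges (Suc r) b = {}"
  "interval_edges a r \<inter> interval_edges (Suc r) b = {}"
  by (auto simp: interval_edges_def split_block_def)

text \<open>If \<open>(i, k)\<close> crosses the cut, an intermediate \<open>j\<close> lies on one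
  side, so \<open>(i, j)\<close> or \<open>(j, k)\<close> crosses as well. The block count is
  \<open>1 + (r - a) + (b - Suc r) = b - a\<close>.\<close>

lemma join_partitions_in_interval_partitions:
  assumes r: "a \<le> r" "r < b"
    and p1: "p1 \<in> interval_partitions a r" and p2: "p2 \<in> interval_partitions (Suc r) b"
  shows "join_partitions a b r p1 p2 \<in> interval_partitions a b"
proof -
  let ?S = "split_block a b r"
  have part1: "partition_on (interval_edges a r) p1" and part2: "partition_on (interval_edges (Suc r) b) p2"
    and card: "card p1 = r - a" "card p2 = b - Suc r"
    and tri: "triangle_condition p1" "triangle_condition p2"
    using p1 p2 by (auto simp: interval_partitions_def)
  have ne: "?S \<noteq> {}" using r by (auto simp: split_block_def)
  have part12: "partition_on (interval_edges a r \<union> interval_edges (Suc r) b) (p1 \<union> p2)"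
    using part1 part2 interval_edges_split_disjoint(3) by (rule partition_on_Un)
  have "partition_on (interval_edges a b) ({?S} \<union> (p1 \<union> p2))"
    unfolding interval_edges_split[OF r]
    by (rule partition_on_Un[OF partition_on_space[OF ne] part12])
      (use interval_edges_split_disjoint in blast)
  moreover have "triangle_condition (insert ?S (p1 \<union> p2))"
    using tri unfolding triangle_condition_def by (fastforce simp: split_block_def)
  moreover have "card (insert ?S (p1 \<union> p2)) = b - a"
  proof -
    have fin: "finite p1" "finite p2"
      using finite_elements[OF finite_interval_edges part1] finite_elements[OF finite_interval_edges part2]
      by auto
    have disj: "?S \<inter> \<Union>p1 = {}" "?S \<inter> \<Union>p2 = {}" "\<Union>p1 \<inter> \<Union>p2 = {}"
      using interval_edges_split_disjoint[where a = a and b = b and r = r]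
      unfolding partition_onD1[OF part1, symmetric] partition_onD1[OF part2, symmetric] by auto
    have "?S \<notin> p1 \<union> p2" using disj(1,2) ne by blast
    moreover have "p1 \<inter> p2 = {}"
    proof (rule ccontr)
      assume "p1 \<inter> p2 \<noteq> {}"
      then obtain B where "B \<in> p1" "B \<in> p2" by blast
      then show False using disj(3) partition_onD3[OF part1] by (metis Sup_upper le_inf_iff subset_empty)
    qed
    ultimately show ?thesis using fin card r by (simp add: card_Un_disjoint)
  qed
  ultimately show ?thesis by (simp add: interval_partitions_def join_partitions_def)
qed

text \<open>The cut is read off from the unique consecutive edge \<open>(r, Suc r)\<close> in the
  block \<open>S\<close> of \<open>(a, b)\<close>.\<close>

lemma interval_partition_split:
  assumes "a < b" and p: "p \<in> interval_partitions a b"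
  obtains r p1 p2 where "a \<le> r" "r < b" "p1 \<in> interval_partitions a r"
    "p2 \<in> interval_partitions (Suc r) b" "p = join_partitions a b r p1 p2"
proof -
  have part: "partition_on (interval_edges a b) p" and tri: "triangle_condition p"
    and card: "card p = b - a"
    using p by (auto simp: interval_partitions_def)
  have edge: "B \<in> p \<Longrightarrow> (i, j) \<in> B \<Longrightarrow> a \<le> i \<and> i < j \<and> j \<le> b" for B i j
    using interval_partition_edge_bounds[OF part] by blast
  have "(a, b) \<in> \<Union>p"
    using partition_onD1[OF part] \<open>a < b\<close> by (auto simp: interval_edges_def)
  then obtain S where S: "S \<in> p" "(a, b) \<in> S" by blast
  then obtain r where r: "a \<le> r" "r < b" and rS: "(r, Suc r) \<in> S"
    using triangle_condition_consecutive_edge[OF tri] \<open>a < b\<close> by blast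
  \<comment> \<open>Below any edge of \<open>S\<close> lies a consecutive edge of \<open>S\<close>,
    which must be \<open>(r, Suc r)\<close>.\<close>
  have S_straddles: "i \<le> r \<and> r < k" if "(i, k) \<in> S" for i k
    using triangle_condition_consecutive_edge[OF tri S(1) that] edge[OF S(1) that]
      consecutive_edge_unique[OF p S(1) rS] by blast
  \<comment> \<open>In the triangle \<open>a, i, b\<close> the edge \<open>(a, i)\<close> does not
    cross the cut, which leaves \<open>(i, b)\<close>. For general crossing edges the triangle
    \<open>i, k, b\<close> is used in the same way.\<close>
  have left_end: "(i, b) \<in> S" if "a \<le> i" "i \<le> r" for i
  proof (cases "i = a")
    case False
    then show ?thesis
      using triangle_conditionD[OF tri S(1), of a i b] S(2) S_straddles[of a i] that r by auto
  qed (use S in simp)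
  have S_eq: "S = split_block a b r"
  proof (intro equalityI subsetI)
    fix e assume "e \<in> S"
    then show "e \<in> split_block a b r"
      using S_straddles edge[OF S(1)] by (cases e) (force simp: split_block_def)
  next
    fix e assume "e \<in> split_block a b r"
    then obtain i k where e: "e = (i, k)" and ik: "a \<le> i" "i \<le> r" "r < k" "k \<le> b"
      by (auto simp: split_block_def)
    show "e \<in> S"
    proof (cases "k = b")
      case False
      then show ?thesis
        using triangle_conditionD[OF tri S(1), of i k b] left_end[of i] S_straddles[of k b] ik e by auto
    qed (use left_end ik e in simp)
  qed
  have side: "B \<subseteq> interval_edges a r \<or> B \<subseteq> interval_edges (Suc r) b" if B: "B \<in> p" "B \<noteq> S" for B
  proof -
    \<comment> \<open>All crossing edges are already in \<open>S\<close>.\<close>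
    have off: "k \<le> r \<or> r < i" if "(i, k) \<in> B" for i k
    proof (rule ccontr)
      assume "\<not> ?thesis"
      then have "(i, k) \<in> S" using edge[OF B(1) that] by (auto simp: S_eq split_block_def)
      then show False using partition_on_unique_block[OF part that _ B(1) S(1)] B(2) by blast
    qed
    have "B \<noteq> {}" using partition_onD3[OF part] B(1) by blast
    then obtain i0 k0 where "(i0, k0) \<in> B" by fast
    then obtain m where m: "(m, Suc m) \<in> B"
      using triangle_condition_consecutive_edge[OF tri B(1)] edge[OF B(1)] by blast
    \<comment> \<open>All edges of \<open>B\<close> span its unique consecutive edge
      \<open>(m, Suc m)\<close>, so none of them can lie on the other side of the cut.\<close>
    have around: "i \<le> m \<and> m < k" if "(i, k) \<in> B" for i k
      using triangle_condition_consecutive_edge[OF tri B(1) that] edge[OF B(1) that]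
        consecutive_edge_unique[OF p B(1) m] by blast
    show ?thesis
    proof (cases "m < r")
      case True
      then have "B \<subseteq> interval_edges a r"
        using off around edge[OF B(1)] by (fastforce simp: interval_edges_def)
      then show ?thesis ..
    next
      case False
      then have "B \<subseteq> interval_edges (Suc r) b"
        using off around edge[OF B(1)] by (fastforce simp: interval_edges_def)
      then show ?thesis ..
    qed
  qed
  define p1 where "p1 = {B \<in> p. B \<subseteq> interval_edges a r}"
  define p2 where "p2 = {B \<in> p. B \<subseteq> interval_edges (Suc r) b}"
  have "S \<noteq> {}" using S by blast
  then have S_notin: "S \<notin> p1 \<union> p2"
    using interval_edges_split_disjoint[where a = a and b = b and r = r] by (auto simp: p1_def p2_def S_eq)
  have p_eq: "p = insert S (p1 \<union> p2)"
    using side S by (auto simp: p1_def p2_def)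
  have union: "split_block a b r \<union> (interval_edges a r \<union> interval_edges (Suc r) b) =
      split_block a b r \<union> (\<Union>p1 \<union> \<Union>p2)"
    using partition_onD1[OF part] p_eq S_eq interval_edges_split[OF r] by simp
  have sub: "\<Union>p1 \<subseteq> interval_edges a r" "\<Union>p2 \<subseteq> interval_edges (Suc r) b"
    by (auto simp: p1_def p2_def)
  have "\<Union>p1 = interval_edges a r" "\<Union>p2 = interval_edges (Suc r) b"
    using union sub interval_edges_split_disjoint[where a = a and b = b and r = r] by blast+
  then have part1: "partition_on (interval_edges a r) p1"
    and part2: "partition_on (interval_edges (Suc r) b) p2"
    using part by (auto simp: partition_on_def p1_def p2_def disjoint_def)
  have tri1: "triangle_condition p1" and tri2: "triangle_condition p2"
    using tri by (auto simp: triangle_condition_def p1_def p2_def)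
  have fin: "finite p1" "finite p2"
    using finite_elements[OF finite_interval_edges part] by (auto simp: p1_def p2_def)
  \<comment> \<open>The upper bounds \<open>r - a\<close> and \<open>b - Suc r\<close> for the two
    parts add up to \<open>b - a - 1\<close>, so both must be attained.\<close>
  have "b - a \<le> Suc (card p1 + card p2)"
    using card card_Un_le[of p1 p2] S_notin fin by (simp add: p_eq)
  then have "card p1 = r - a" "card p2 = b - Suc r"
    using card_interval_partition_le[OF part1 tri1] card_interval_partition_le[OF part2 tri2] r by auto
  then have "p1 \<in> interval_partitions a r" "p2 \<in> interval_partitions (Suc r) b"
    using part1 part2 tri1 tri2 by (auto simp: interval_partitions_def)
  then show ?thesis
    using that[OF r] p_eq S_eq by (simp add: join_partitions_def)
qed

lemma blocks_subset_interval_edges: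
  assumes "p \<in> interval_partitions a b" "B \<in> p"
  shows "B \<subseteq> interval_edges a b" "B \<noteq> {}"
  using assms unfolding interval_partitions_def partition_on_def by auto

text \<open>The block of \<open>(a, b)\<close> determines \<open>r\<close>, and the remaining blocks
  are sorted by the side on which they lie.\<close>

lemma inj_on_join_partitions:
  "inj_on (\<lambda>(r, p1, p2). join_partitions a b r p1 p2)
     (SIGMA r:{a..<b}. interval_partitions a r \<times> interval_partitions (Suc r) b)"
proof (rule inj_onI)
  let ?D = "SIGMA r:{a..<b}. interval_partitions a r \<times> interval_partitions (Suc r) b"
  fix x y
  assume xy: "x \<in> ?D" "y \<in> ?D"
    and eq': "(\<lambda>(r, p1, p2). join_partitions a b r p1 p2) x = (\<lambda>(r, p1, p2). join_partitions a b r p1 p2) y"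
  obtain r p1 p2 s p1' p2' where x: "x = (r, p1, p2)" and y: "y = (s, p1', p2')"
    by (metis prod_cases3)
  have r: "r \<in> {a..<b}" and s: "s \<in> {a..<b}"
    and p1: "p1 \<in> interval_partitions a r" and p2: "p2 \<in> interval_partitions (Suc r) b"
    and p1': "p1' \<in> interval_partitions a s" and p2': "p2' \<in> interval_partitions (Suc s) b"
    and eq: "join_partitions a b r p1 p2 = join_partitions a b s p1' p2'"
    using xy eq' unfolding x y by auto
  have part: "partition_on (interval_edges a b) (join_partitions a b r p1 p2)"
    using join_partitions_in_interval_partitions[of a r b p1 p2] r p1 p2
    by (auto simp: interval_partitions_def)
  have mem: "(a, b) \<in> split_block a b r" "(a, b) \<in> split_block a b s"
    using r s by (auto simp: split_block_def)
  have "split_block a b s \<in> join_partitions a b r p1 p2"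
    unfolding eq by (simp add: join_partitions_def)
  then have "split_block a b r = split_block a b s"
    using partition_on_unique_block[OF part mem] by (simp add: join_partitions_def)
  then have "{a..r} = {a..s}"
    using r s by (simp add: split_block_def times_eq_iff)
  then have rs: "r = s" using r by simp
  \<comment> \<open>Blocks are nonempty and the two sides share no edge, so no block is selected by
    both filters; the crossing block is selected by neither.\<close>
  have recover: "q1 = {B \<in> join_partitions a b r q1 q2. B \<subseteq> interval_edges a r} \<and>
      q2 = {B \<in> join_partitions a b r q1 q2. B \<subseteq> interval_edges (Suc r) b}"
    if "q1 \<in> interval_partitions a r" "q2 \<in> interval_partitions (Suc r) b" for q1 q2
  proof -
    have "split_block a b r \<noteq> {}" using mem by blast
    then have "\<not> split_block a b r \<subseteq> interval_edges a r" "\<not> split_block a b r \<subseteq> interval_edges (Suc r) b"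
      using interval_edges_split_disjoint(1)[of a b r] interval_edges_split_disjoint(2)[of a b r] by blast+
    moreover have "B \<subseteq> interval_edges a r \<and> \<not> B \<subseteq> interval_edges (Suc r) b" if "B \<in> q1" for B
      using blocks_subset_interval_edges[OF \<open>q1 \<in> _\<close> that] interval_edges_split_disjoint(3)[of a r b] by blast
    moreover have "B \<subseteq> interval_edges (Suc r) b \<and> \<not> B \<subseteq> interval_edges a r" if "B \<in> q2" for B
      using blocks_subset_interval_edges[OF \<open>q2 \<in> _\<close> that] interval_edges_split_disjoint(3)[of a r b] by blast
    ultimately show ?thesis by (auto simp: join_partitions_def)
  qed
  have "p1 = p1' \<and> p2 = p2'"
    using recover[OF p1 p2] recover[of p1' p2'] p1' p2' eq rs by metis
  then show "x = y" by (simp add: x y rs)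
qed

lemma bij_betw_join_partitions:
  assumes "a < b"
  shows "bij_betw (\<lambda>(r, p1, p2). join_partitions a b r p1 p2)
     (SIGMA r:{a..<b}. interval_partitions a r \<times> interval_partitions (Suc r) b)
     (interval_partitions a b)"
  unfolding bij_betw_def
proof (intro conjI inj_on_join_partitions equalityI subsetI)
  fix p assume "p \<in> interval_partitions a b"
  then obtain r p1 p2 where "a \<le> r" "r < b" "p1 \<in> interval_partitions a r"
    "p2 \<in> interval_partitions (Suc r) b" "p = join_partitions a b r p1 p2"
    using interval_partition_split[OF assms] by metis
  then show "p \<in> (\<lambda>(r, p1, p2). join_partitions a b r p1 p2) `
      (SIGMA r:{a..<b}. interval_partitions a r \<times> interval_partitions (Suc r) b)"
    by force
qed (auto intro: join_partitions_in_interval_partitions)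

section \<open>The recursion for the generating function\<close>

lemma minimal_edges_Un: "minimal_edges (p \<union> p') = minimal_edges p \<union> minimal_edges p'"
  by (auto simp: minimal_edges_def)

lemma minimal_edges_subset: "minimal_edges p \<subseteq> \<Union>p"
  by (auto simp: minimal_edges_def)

text \<open>With \<open>(i, k)\<close> the block also contains \<open>(a, k)\<close>, so a minimal
  edge must start at \<open>a\<close>. When \<open>r < b\<close> this yields the
  \<open>b - r\<close> edges behind the power of \<open>q\<close> in the recursion.\<close>

lemma minimal_edges_split_block:
  assumes "a \<le> r"
  shows "minimal_edges {split_block a b r} = {a} \<times> {Suc r..b}"
proof -
  have "i = a" if "(i, k) \<in> minimal_edges {split_block a b r}" for i k
  proof -
    have "(i, k) \<in> split_block a b r" "\<forall>(c, d)\<in>split_block a b r. i \<le> c"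
      using that by (auto simp: minimal_edges_def)
    moreover from this have "(a, k) \<in> split_block a b r" using assms by (auto simp: split_block_def)
    ultimately show "i = a" by (fastforce simp: split_block_def)
  qed
  moreover have "minimal_edges {split_block a b r} \<subseteq> split_block a b r"
    by (auto simp: minimal_edges_def)
  moreover have "{a} \<times> {Suc r..b} \<subseteq> minimal_edges {split_block a b r}"
    using assms by (auto simp: minimal_edges_def split_block_def)
  ultimately show ?thesis unfolding split_block_def by fast
qed

text \<open>Minimality is tested inside a single block, so the counts of the crossing block and of
  the two parts add up.\<close>

lemma minimal_join_partitions:
  assumes r: "a \<le> r"
    and p1: "p1 \<in> interval_partitions a r" and p2: "p2 \<in> interval_partitions (Suc r) b"
  shows "minimal (join_partitions a b r p1 p2) = (b - r) + minimal p1 + minimal p2"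
proof -
  let ?S = "split_block a b r"
  have sub: "minimal_edges {?S} \<subseteq> ?S" "minimal_edges p1 \<subseteq> interval_edges a r"
    "minimal_edges p2 \<subseteq> interval_edges (Suc r) b"
    using minimal_edges_subset blocks_subset_interval_edges[OF p1] blocks_subset_interval_edges[OF p2]
    by blast+
  have fin: "finite (minimal_edges {?S})" "finite (minimal_edges p1)" "finite (minimal_edges p2)"
    using finite_subset[OF sub(2) finite_interval_edges] finite_subset[OF sub(3) finite_interval_edges]
    by (simp_all add: minimal_edges_split_block[OF r])
  have disj: "minimal_edges {?S} \<inter> (minimal_edges p1 \<union> minimal_edges p2) = {}"
    "minimal_edges p1 \<inter> minimal_edges p2 = {}"
    using sub interval_edges_split_disjoint[where a = a and b = b and r = r] by blast+
  have "minimal_edges (join_partitions a b r p1 p2) =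
      minimal_edges {?S} \<union> (minimal_edges p1 \<union> minimal_edges p2)"
    using minimal_edges_Un[of "{?S}" "p1 \<union> p2"] by (simp add: join_partitions_def minimal_edges_Un)
  then show ?thesis
    using fin disj by (simp add: minimal_def card_Un_disjoint minimal_edges_split_block[OF r])
qed

lemma sum_minimal_rec:
  fixes q :: "'a::comm_semiring_1"
  assumes "a < b"
  shows "(\<Sum>p\<in>interval_partitions a b. q ^ minimal p) =
    (\<Sum>r\<in>{a..<b}. q ^ (b - r) * (\<Sum>p\<in>interval_partitions a r. q ^ minimal p) *
       (\<Sum>p\<in>interval_partitions (Suc r) b. q ^ minimal p))"
proof -
  have fin: "finite (interval_partitions c d)" for c d
    by (rule finite_subset[OF _ finitely_many_partition_on[OF finite_interval_edges[of c d]]])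
      (auto simp: interval_partitions_def)
  have "(\<Sum>p\<in>interval_partitions a b. q ^ minimal p) =
      (\<Sum>(r, p1, p2)\<in>(SIGMA r:{a..<b}. interval_partitions a r \<times> interval_partitions (Suc r) b).
         q ^ minimal (join_partitions a b r p1 p2))"
    by (subst sum.reindex_bij_betw[OF bij_betw_join_partitions[OF assms], symmetric])
      (simp add: case_prod_unfold)
  also have "\<dots> = (\<Sum>r\<in>{a..<b}. \<Sum>(p1, p2)\<in>interval_partitions a r \<times> interval_partitions (Suc r) b.
      q ^ minimal (join_partitions a b r p1 p2))"
    by (subst sum.Sigma) (auto simp: fin)
  also have "\<dots> = (\<Sum>r\<in>{a..<b}. q ^ (b - r) * (\<Sum>p\<in>interval_partitions a r. q ^ minimal p) *
       (\<Sum>p\<in>interval_partitions (Suc r) b. q ^ minimal p))"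
  proof (rule sum.cong[OF refl])
    fix r assume r: "r \<in> {a..<b}"
    have "(\<Sum>(p1, p2)\<in>interval_partitions a r \<times> interval_partitions (Suc r) b.
        q ^ minimal (join_partitions a b r p1 p2)) =
      (\<Sum>(p1, p2)\<in>interval_partitions a r \<times> interval_partitions (Suc r) b.
        q ^ (b - r) * (q ^ minimal p1 * q ^ minimal p2))"
      using r by (intro sum.cong) (auto simp: minimal_join_partitions add.assoc simp flip: power_add)
    also have "\<dots> = q ^ (b - r) * ((\<Sum>p\<in>interval_partitions a r. q ^ minimal p) *
       (\<Sum>p\<in>interval_partitions (Suc r) b. q ^ minimal p))"
      unfolding sum_product sum.cartesian_product by (simp add: sum_distrib_left case_prod_unfold)
    finally show "(\<Sum>(p1, p2)\<in>interval_partitions a r \<times> interval_partitions (Suc r) b.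
        q ^ minimal (join_partitions a b r p1 p2)) =
      q ^ (b - r) * (\<Sum>p\<in>interval_partitions a r. q ^ minimal p) *
       (\<Sum>p\<in>interval_partitions (Suc r) b. q ^ minimal p)"
      by (simp add: mult.assoc)
  qed
  finally show ?thesis .
qed

section \<open>Solving the recursion by q-Catalan numbers\<close>

text \<open>Pairs from \<open>m + n\<close> points lie within one of the two groups or join
  them.\<close>

lemma choose_two_add: "(m + n) choose 2 = (m choose 2) + (n choose 2) + m * n"
  by (induction m) (simp_all add: numeral_2_eq_2)

text \<open>An interval from \<open>a\<close> to \<open>a + d\<close> has \<open>d + 1\<close>
  vertices, hence the binomial in \<open>Suc d\<close> next to the Catalan index \<open>d\<close>.
  The value does not depend on \<open>a\<close>, so the induction hypothesis covers both parts of a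
  cut.\<close>

lemma sum_minimal_interval:
  fixes q :: "'a::field"
  assumes "q \<noteq> 0"
  shows "(\<Sum>p\<in>interval_partitions a (a + d). q ^ minimal p) =
    q ^ (Suc d choose 2) * q_catalan d (inverse q)"
proof (induction d arbitrary: a rule: less_induct)
  case (less d)
  show ?case
  proof (cases d)
    case 0
    have "interval_edges a a = {}" by (auto simp: interval_edges_def)
    then have "interval_partitions a a = {{}}"
      by (auto simp: interval_partitions_def partition_on_empty triangle_condition_def)
    then show ?thesis using 0 by (simp add: minimal_def minimal_edges_def numeral_2_eq_2)
  next
    case (Suc m)
    let ?C = "\<lambda>k. q_catalan k (inverse q)"
    have "(\<Sum>p\<in>interval_partitions a (a + d). q ^ minimal p) =
        (\<Sum>r\<in>{a..<a + Suc m}. q ^ (a + Suc m - r) * (\<Sum>p\<in>interval_partitions a r. q ^ minimal p) *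
       (\<Sum>p\<in>interval_partitions (Suc r) (a + Suc m). q ^ minimal p))"
      unfolding Suc by (rule sum_minimal_rec) simp
    also have "\<dots> = (\<Sum>k\<le>m. q ^ Suc k * (\<Sum>p\<in>interval_partitions a (a + (m - k)). q ^ minimal p) *
       (\<Sum>p\<in>interval_partitions (Suc (a + (m - k))) (Suc (a + (m - k)) + k). q ^ minimal p))"
      \<comment> \<open>The new index \<open>k = a + m - r\<close> is the length of the right part;
        the left part has length \<open>m - k\<close>, and the crossing block contributes
        \<open>k + 1\<close> minimal edges.\<close>
      by (rule sum.reindex_bij_witness[of _ "\<lambda>k. a + (m - k)" "\<lambda>r. a + m - r"]) (auto simp: Suc_diff_le)
    also have "\<dots> = (\<Sum>k\<le>m. q ^ (Suc d choose 2) *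
        (inverse q ^ ((k + 1) * (m - k)) * ?C k * ?C (m - k)))"
    proof (rule sum.cong[OF refl])
      fix k assume "k \<in> {..m}"
      then have k: "k \<le> m" by simp
      have "Suc d = Suc k + Suc (m - k)" using k Suc by simp
      \<comment> \<open>The cross term \<open>(k + 1) * (m - k + 1)\<close> splits into
        \<open>k + 1\<close>, the exponent from the crossing block, and
        \<open>(k + 1) * (m - k)\<close>, the exponent in the Catalan recursion, which enters with
        \<open>inverse q\<close>.\<close>
      then have "Suc d choose 2 = Suc k + (Suc (m - k) choose 2) + (Suc k choose 2) + (k + 1) * (m - k)"
        by (simp only: choose_two_add) simp
      then have "q ^ (Suc d choose 2) * inverse q ^ ((k + 1) * (m - k)) =
          q ^ Suc k * q ^ (Suc (m - k) choose 2) * q ^ (Suc k choose 2)"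
        using assms by (simp only: power_add power_inverse) (simp del: power_Suc mult_Suc binomial_Suc_Suc)
      then show "q ^ Suc k * (\<Sum>p\<in>interval_partitions a (a + (m - k)). q ^ minimal p) *
         (\<Sum>p\<in>interval_partitions (Suc (a + (m - k))) (Suc (a + (m - k)) + k). q ^ minimal p) =
        q ^ (Suc d choose 2) * (inverse q ^ ((k + 1) * (m - k)) * ?C k * ?C (m - k))"
        using less.IH[of "m - k" a] less.IH[of k "Suc (a + (m - k))"] k Suc
        by (simp only: mult_ac less_Suc_eq_le diff_le_self)
    qed
    also have "\<dots> = q ^ (Suc d choose 2) * ?C d"
      unfolding Suc q_catalan.simps sum_distrib_left ..
    finally show ?thesis .
  qed
qed

theorem proposition3p22:
  fixes n :: nat and q :: "'a::field"
  assumes "n > 1" and "q \<noteq> 0"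
  shows "(\<Sum>p\<in>max_transitive_partitions n. q ^ minimal p) =
         q ^ (n choose 2) * q_catalan (n - 1) (inverse q)"
  using sum_minimal_interval[OF assms(2), of 1 "n - 1"] assms(1)
  by (simp add: max_transitive_partitions_eq)

end
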